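(* Let $A,B:\mathbb S\to Set$ be functors and $\tau:A\to B$ a natural transformation. Then $\tau$ is weakly cartesian if and only if $\hat\tau:\hat A\to\hat B$ is weakly cartesian.
   Context: Notation: $(n]=\{1,\dots,n\}$ for $n\in\omega=\{0,1,2,\dots\}$. $\mathbb S$ is the category with objects $(n]$, $n\in\omega$, and surjections as morphisms. For a set $X$, $\left[{X\atop n}\right]$ is the set of injections $(n]\to X$, on which $S_n$ acts on the right by composition. For $A:\mathbb S\to Set$ write $A_n=A((n])$ and let $\left[{X\atop n}\right]\otimes_n A_n$ be the quotient of $\left[{X\atop n}\right]\times A_n$ by $(\vec x\circ\sigma,a)\sim(\vec x,A(\sigma)(a))$, $\sigma\in S_n$; classes are written $[\vec x,a]$. The functor $\hat A:Set\to Set$ is $\hat A(X)=\sum_{n\in\omega}\left[{X\atop n}\right]\otimes_nA_n$; for $f:X\to Y$, $\hat A(f)([\vec x,a])=[\vec y,A(\alpha)(a)]$, where $f\circ\vec x=\vec y\circ\alpha$ with $\alpha:(n]\to(m]$ surjective and $\vec y:(m]\to Y$ injective. For $\tau:A\to B$, $\hat\tau_X([\vec x,a])=[\vec x,\tau_n(a)]$. A natural transformation between $Set$-valued functors is weakly cartesian if all its naturality squares are weak pullbacks (existence but not necessarily uniqueness in the universal property). *)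

theory Defs
  imports "HOL-Library.FuncSet"
begin

text \<open>
  Every value of the type \<open>'o\<close> is an object; \<open>Comp C X Y Z g f\<close> is the composite of
  \<open>f : X \<rightarrow> Y\<close> and \<open>g : Y \<rightarrow> Z\<close>.
\<close>

record ('o, 'm) category =
  Hom :: "'o \<Rightarrow> 'o \<Rightarrow> 'm set"
  Id :: "'o \<Rightarrow> 'm"
  Comp :: "'o \<Rightarrow> 'o \<Rightarrow> 'o \<Rightarrow> 'm \<Rightarrow> 'm \<Rightarrow> 'm"

record ('o, 'm, 'a) set_functor =
  Ob :: "'o \<Rightarrow> 'a set"
  Ar :: "'o \<Rightarrow> 'o \<Rightarrow> 'm \<Rightarrow> 'a \<Rightarrow> 'a"

definition functor_to_Set :: "('o, 'm) category \<Rightarrow> ('o, 'm, 'a) set_functor \<Rightarrow> bool" where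
  "functor_to_Set C F \<longleftrightarrow>
     (\<forall>X Y. \<forall>f\<in>Hom C X Y. Ar F X Y f \<in> Ob F X \<rightarrow> Ob F Y) \<and>
     (\<forall>X. \<forall>a\<in>Ob F X. Ar F X X (Id C X) a = a) \<and>
     (\<forall>X Y Z. \<forall>f\<in>Hom C X Y. \<forall>g\<in>Hom C Y Z. \<forall>a\<in>Ob F X.
        Ar F X Z (Comp C X Y Z g f) a = Ar F Y Z g (Ar F X Y f a))"

definition natural_transformation ::
  "('o, 'm) category \<Rightarrow> ('o, 'm, 'a) set_functor \<Rightarrow> ('o, 'm, 'b) set_functor \<Rightarrow> ('o \<Rightarrow> 'a \<Rightarrow> 'b) \<Rightarrow> bool" where
  "natural_transformation C F G \<tau> \<longleftrightarrow>
     (\<forall>X. \<tau> X \<in> Ob F X \<rightarrow> Ob G X) \<and>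
     (\<forall>X Y. \<forall>f\<in>Hom C X Y. \<forall>a\<in>Ob F X. \<tau> Y (Ar F X Y f a) = Ar G X Y f (\<tau> X a))"

text \<open>
  The square of sets with projections \<open>p : P \<rightarrow> A\<close>, \<open>q : P \<rightarrow> B\<close> and cospan \<open>f : A \<rightarrow> C\<close>, \<open>g : B \<rightarrow> C\<close>
  commutes and every cone over the cospan factors, not necessarily uniquely, through \<open>P\<close>.
  A HOL formula cannot quantify over the sets of all types, so the vertex \<open>Q\<close> of the cone ranges
  over the sets of elements of a type \<open>'q\<close>; by \<open>weak_pullback_cone_type\<close> below, the choice of
  \<open>'q\<close> is immaterial.
\<close>

definition weak_pullback ::
  "'q itself \<Rightarrow> 'p set \<Rightarrow> 'a set \<Rightarrow> 'b set \<Rightarrow> 'c set \<Rightarrow>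
   ('p \<Rightarrow> 'a) \<Rightarrow> ('p \<Rightarrow> 'b) \<Rightarrow> ('a \<Rightarrow> 'c) \<Rightarrow> ('b \<Rightarrow> 'c) \<Rightarrow> bool" where
  "weak_pullback TYPE('q) P A B C p q f g \<longleftrightarrow>
     p \<in> P \<rightarrow> A \<and> q \<in> P \<rightarrow> B \<and> f \<in> A \<rightarrow> C \<and> g \<in> B \<rightarrow> C \<and>
     (\<forall>x\<in>P. f (p x) = g (q x)) \<and>
     (\<forall>Q :: 'q set. \<forall>u\<in>Q \<rightarrow> A. \<forall>v\<in>Q \<rightarrow> B.
        (\<forall>t\<in>Q. f (u t) = g (v t)) \<longrightarrow>
        (\<exists>h\<in>Q \<rightarrow> P. \<forall>t\<in>Q. p (h t) = u t \<and> q (h t) = v t))"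

definition weakly_cartesian ::
  "'q itself \<Rightarrow> ('o, 'm) category \<Rightarrow> ('o, 'm, 'a) set_functor \<Rightarrow> ('o, 'm, 'b) set_functor \<Rightarrow>
   ('o \<Rightarrow> 'a \<Rightarrow> 'b) \<Rightarrow> bool" where
  "weakly_cartesian TYPE('q) C F G \<tau> \<longleftrightarrow>
     (\<forall>X Y. \<forall>f\<in>Hom C X Y.
        weak_pullback TYPE('q) (Ob F X) (Ob F Y) (Ob G X) (Ob G Y)
          (Ar F X Y f) (\<tau> X) (\<tau> Y) (Ar G X Y f))"

lemma weak_pullback_iff_elements:
  "weak_pullback TYPE('q) P A B C p q f g \<longleftrightarrow>
     p \<in> P \<rightarrow> A \<and> q \<in> P \<rightarrow> B \<and> f \<in> A \<rightarrow> C \<and> g \<in> B \<rightarrow> C \<and>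
     (\<forall>x\<in>P. f (p x) = g (q x)) \<and>
     (\<forall>a\<in>A. \<forall>b\<in>B. f a = g b \<longrightarrow> (\<exists>x\<in>P. p x = a \<and> q x = b))"
  (is "?L \<longleftrightarrow> ?R")
proof
  assume L: ?L
  have "\<exists>x\<in>P. p x = a \<and> q x = b" if ab: "a \<in> A" "b \<in> B" "f a = g b" for a b
  proof -
    have "\<forall>Q :: 'q set. \<forall>u\<in>Q \<rightarrow> A. \<forall>v\<in>Q \<rightarrow> B. (\<forall>t\<in>Q. f (u t) = g (v t)) \<longrightarrow>
      (\<exists>h\<in>Q \<rightarrow> P. \<forall>t\<in>Q. p (h t) = u t \<and> q (h t) = v t)"
      using L unfolding weak_pullback_def by (elim conjE)
    from this[rule_format, of "\<lambda>_. a" UNIV "\<lambda>_. b"] ab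
    obtain h where h: "h \<in> (UNIV :: 'q set) \<rightarrow> P" "\<forall>t. p (h t) = a \<and> q (h t) = b"
      by auto
    from h(1) have "h undefined \<in> P" by (rule funcset_mem) simp
    with h(2) show ?thesis by metis
  qed
  with L show ?R unfolding weak_pullback_def by (elim conjE, intro conjI ballI impI) auto
next
  assume R: ?R
  have "\<exists>h\<in>Q \<rightarrow> P. \<forall>t\<in>Q. p (h t) = u t \<and> q (h t) = v t"
    if uv: "u \<in> Q \<rightarrow> A" "v \<in> Q \<rightarrow> B" "\<forall>t\<in>Q. f (u t) = g (v t)" for Q :: "'q set" and u v
  proof -
    have "\<exists>x. x \<in> P \<and> p x = u t \<and> q x = v t" if "t \<in> Q" for t
    proof -
      from R have "\<forall>a\<in>A. \<forall>b\<in>B. f a = g b \<longrightarrow> (\<exists>x\<in>P. p x = a \<and> q x = b)"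
        by (elim conjE)
      from this[rule_format, of "u t" "v t"] funcset_mem[OF uv(1) that] funcset_mem[OF uv(2) that]
        uv(3) that
      show ?thesis by auto
    qed
    then obtain h where "\<And>t. t \<in> Q \<Longrightarrow> h t \<in> P \<and> p (h t) = u t \<and> q (h t) = v t"
      by metis
    then show ?thesis by (intro bexI[of _ h]) auto
  qed
  with R show ?L unfolding weak_pullback_def by (elim conjE, intro conjI allI ballI impI) auto
qed

lemma weak_pullback_cone_type:
  "weak_pullback TYPE('q) P A B C p q f g \<longleftrightarrow> weak_pullback TYPE('r) P A B C p q f g"
  unfolding weak_pullback_iff_elements ..


abbreviation seg :: "nat \<Rightarrow> nat set" where
  "seg n \<equiv> {1..n}"

text \<open>
  Maps between sets are represented by extensional functions, so that equality of arrows is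
  equality in HOL.
\<close>

definition Surj :: "nat \<Rightarrow> nat \<Rightarrow> (nat \<Rightarrow> nat) set" where
  "Surj n m = {\<alpha> \<in> seg n \<rightarrow>\<^sub>E seg m. \<alpha> ` seg n = seg m}"

definition Inj :: "nat \<Rightarrow> 'x set \<Rightarrow> (nat \<Rightarrow> 'x) set" where
  "Inj n X = {x \<in> seg n \<rightarrow>\<^sub>E X. inj_on x (seg n)}"

definition Sym :: "nat \<Rightarrow> (nat \<Rightarrow> nat) set" where
  "Sym n = {\<sigma> \<in> seg n \<rightarrow>\<^sub>E seg n. bij_betw \<sigma> (seg n) (seg n)}"

definition S_cat :: "(nat, nat \<Rightarrow> nat) category" where
  "S_cat = \<lparr>Hom = Surj, Id = (\<lambda>n. \<lambda>i\<in>seg n. i), Comp = (\<lambda>n m k \<beta> \<alpha>. compose (seg n) \<beta> \<alpha>)\<rparr>"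

text \<open>
  The objects are all sets of elements of the type \<open>'x\<close>, which plays the role of the universe.
  It should be infinite, so that every finite set has a copy among the objects.
\<close>

definition Set_cat :: "('x set, 'x \<Rightarrow> 'x) category" where
  "Set_cat = \<lparr>Hom = (\<lambda>X Y. X \<rightarrow>\<^sub>E Y), Id = (\<lambda>X. \<lambda>x\<in>X. x), Comp = (\<lambda>X Y Z g f. compose X g f)\<rparr>"

type_synonym 'a S_functor = "(nat, nat \<Rightarrow> nat, 'a) set_functor"

text \<open>
  The generating relation is already an equivalence relation (\<open>equiv_tensor_rel\<close> below), since the
  permutations form a group and \<open>A\<close> is a functor.
\<close>

definition tensor_rel ::
  "'a S_functor \<Rightarrow> 'x set \<Rightarrow> nat \<Rightarrow> (((nat \<Rightarrow> 'x) \<times> 'a) \<times> ((nat \<Rightarrow> 'x) \<times> 'a)) set" where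
  "tensor_rel A X n =
     {((compose (seg n) x \<sigma>, a), (x, Ar A n n \<sigma> a)) | x \<sigma> a.
        x \<in> Inj n X \<and> \<sigma> \<in> Sym n \<and> a \<in> Ob A n}"

definition tensor :: "'a S_functor \<Rightarrow> 'x set \<Rightarrow> nat \<Rightarrow> ((nat \<Rightarrow> 'x) \<times> 'a) set set" where
  "tensor A X n = (Inj n X \<times> Ob A n) // tensor_rel A X n"

definition cls :: "'a S_functor \<Rightarrow> 'x set \<Rightarrow> nat \<Rightarrow> (nat \<Rightarrow> 'x) \<Rightarrow> 'a \<Rightarrow> ((nat \<Rightarrow> 'x) \<times> 'a) set" where
  "cls A X n x a = tensor_rel A X n `` {(x, a)}"

text \<open>
  The definite descriptions in \<open>hat\<close> and \<open>hat_trans\<close> are justified by \<open>hat_Ar_cls\<close> and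
  \<open>hat_trans_cls\<close> below.
\<close>

definition hat ::
  "'a S_functor \<Rightarrow> ('x set, 'x \<Rightarrow> 'x, nat \<times> ((nat \<Rightarrow> 'x) \<times> 'a) set) set_functor" where
  "hat A = \<lparr>
     Ob = (\<lambda>X. SIGMA n : UNIV. tensor A X n),
     Ar = (\<lambda>X Y f c. THE d. \<exists>n m x a \<alpha> y.
             x \<in> Inj n X \<and> a \<in> Ob A n \<and> c = (n, cls A X n x a) \<and>
             \<alpha> \<in> Surj n m \<and> y \<in> Inj m Y \<and> compose (seg n) f x = compose (seg n) y \<alpha> \<and>
             d = (m, cls A Y m y (Ar A n m \<alpha> a)))\<rparr>"

definition hat_trans ::
  "'a S_functor \<Rightarrow> 'b S_functor \<Rightarrow> (nat \<Rightarrow> 'a \<Rightarrow> 'b) \<Rightarrow>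
   'x set \<Rightarrow> nat \<times> ((nat \<Rightarrow> 'x) \<times> 'a) set \<Rightarrow> nat \<times> ((nat \<Rightarrow> 'x) \<times> 'b) set" where
  "hat_trans A B \<tau> X c = (THE d. \<exists>n x a.
      x \<in> Inj n X \<and> a \<in> Ob A n \<and> c = (n, cls A X n x a) \<and> d = (n, cls B X n x (\<tau> n a)))"


lemma Sym_subset_Surj: "\<sigma> \<in> Sym n \<Longrightarrow> \<sigma> \<in> Surj n n"
  by (auto simp: Sym_def Surj_def bij_betw_def)

lemma functor_S:
  assumes "functor_to_Set S_cat A"
  shows "\<alpha> \<in> Surj n m \<Longrightarrow> a \<in> Ob A n \<Longrightarrow> Ar A n m \<alpha> a \<in> Ob A m"
    and "a \<in> Ob A n \<Longrightarrow> Ar A n n (\<lambda>i\<in>seg n. i) a = a"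
    and "\<alpha> \<in> Surj n m \<Longrightarrow> \<beta> \<in> Surj m k \<Longrightarrow> a \<in> Ob A n \<Longrightarrow>
         Ar A n k (compose (seg n) \<beta> \<alpha>) a = Ar A m k \<beta> (Ar A n m \<alpha> a)"
  using assms unfolding functor_to_Set_def S_cat_def by auto

lemma Id_Sym: "(\<lambda>i\<in>seg n. i) \<in> Sym n"
proof -
  have "bij_betw (\<lambda>i. i) (seg n) (seg n)" by (auto simp: bij_betw_def)
  then show ?thesis unfolding Sym_def by simp
qed

lemma Inj_compose_Id: "x \<in> Inj n X \<Longrightarrow> compose (seg n) x (\<lambda>i\<in>seg n. i) = x"
  unfolding Inj_def PiE_def by (auto intro: compose_Id)

lemma compose_Sym:
  assumes "\<sigma> \<in> Sym n" "\<rho> \<in> Sym n"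
  shows "compose (seg n) \<rho> \<sigma> \<in> Sym n"
  using assms funcset_compose[of \<sigma> "seg n" "seg n" \<rho> "seg n"]
    bij_betw_compose[of \<sigma> "seg n" "seg n" \<rho> "seg n"]
  unfolding Sym_def PiE_def by auto

lemma compose_Inj_Sym:
  assumes "x \<in> Inj n X" "\<sigma> \<in> Sym n"
  shows "compose (seg n) x \<sigma> \<in> Inj n X"
  using assms funcset_compose[of \<sigma> "seg n" "seg n" x X]
    inj_on_compose[of \<sigma> "seg n" "seg n" x]
  unfolding Sym_def Inj_def PiE_def by auto

lemma Sym_inverse:
  assumes "\<sigma> \<in> Sym n"
  obtains \<rho> where "\<rho> \<in> Sym n"
    "compose (seg n) \<rho> \<sigma> = (\<lambda>i\<in>seg n. i)" "compose (seg n) \<sigma> \<rho> = (\<lambda>i\<in>seg n. i)"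
proof
  have b: "bij_betw \<sigma> (seg n) (seg n)" using assms by (simp add: Sym_def)
  let ?\<rho> = "\<lambda>i\<in>seg n. inv_into (seg n) \<sigma> i"
  have "bij_betw (inv_into (seg n) \<sigma>) (seg n) (seg n)" by (rule bij_betw_inv_into[OF b])
  then show "?\<rho> \<in> Sym n"
    unfolding Sym_def by (auto dest: bij_betwE)
  show "compose (seg n) ?\<rho> \<sigma> = (\<lambda>i\<in>seg n. i)" by (rule compose_inv_into_id[OF b])
  show "compose (seg n) \<sigma> ?\<rho> = (\<lambda>i\<in>seg n. i)"
    by (rule compose_id_inv_into) (use b in \<open>simp add: bij_betw_def\<close>)
qed

lemma Sym_fun: "\<sigma> \<in> Sym n \<Longrightarrow> \<sigma> \<in> seg n \<rightarrow> seg n"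
  by (auto simp: Sym_def)

lemma tensor_relI:
  "x \<in> Inj n X \<Longrightarrow> \<sigma> \<in> Sym n \<Longrightarrow> a \<in> Ob A n \<Longrightarrow>
   ((compose (seg n) x \<sigma>, a), (x, Ar A n n \<sigma> a)) \<in> tensor_rel A X n"
  unfolding tensor_rel_def by blast

lemma equiv_tensor_rel:
  assumes A: "functor_to_Set S_cat A"
  shows "equiv (Inj n X \<times> Ob A n) (tensor_rel A X n)"
proof (rule equivI)
  show "tensor_rel A X n \<subseteq> (Inj n X \<times> Ob A n) \<times> (Inj n X \<times> Ob A n)"
    unfolding tensor_rel_def
    by (clarify, intro conjI SigmaI compose_Inj_Sym functor_S(1)[OF A] Sym_subset_Surj)
  show "refl_on (Inj n X \<times> Ob A n) (tensor_rel A X n)"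
  proof (rule refl_onI, clarify)
    fix x :: "nat \<Rightarrow> 'b" and a assume "x \<in> Inj n X" "a \<in> Ob A n"
    then have "x \<in> Inj n X" "a \<in> Ob A n" "compose (seg n) x (\<lambda>i\<in>seg n. i) = x"
      "Ar A n n (\<lambda>i\<in>seg n. i) a = a"
      using Inj_compose_Id functor_S(2)[OF A] by auto
    then show "((x, a), (x, a)) \<in> tensor_rel A X n"
      using tensor_relI[OF _ Id_Sym, of x n X a A] by simp
  qed
  show "sym (tensor_rel A X n)"
  proof (rule symI)
    fix s t assume "(s, t) \<in> tensor_rel A X n"
    then obtain x \<sigma> a where h: "x \<in> Inj n X" "\<sigma> \<in> Sym n" "a \<in> Ob A n"
      "s = (compose (seg n) x \<sigma>, a)" "t = (x, Ar A n n \<sigma> a)"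
      unfolding tensor_rel_def by auto
    obtain \<rho> where r: "\<rho> \<in> Sym n"
      "compose (seg n) \<rho> \<sigma> = (\<lambda>i\<in>seg n. i)" "compose (seg n) \<sigma> \<rho> = (\<lambda>i\<in>seg n. i)"
      using Sym_inverse[OF h(2)] .
    have "compose (seg n) (compose (seg n) x \<sigma>) \<rho> = x"
      using compose_assoc[OF Sym_fun[OF r(1)], of x \<sigma>] r(3) Inj_compose_Id[OF h(1)] by metis
    moreover have "Ar A n n \<rho> (Ar A n n \<sigma> a) = a"
      using functor_S(2,3)[OF A] r h Sym_subset_Surj by metis
    moreover have "Ar A n n \<sigma> a \<in> Ob A n"
      using functor_S(1)[OF A] h Sym_subset_Surj by blast
    ultimately show "(t, s) \<in> tensor_rel A X n"
      using tensor_relI[OF compose_Inj_Sym[OF h(1,2)] r(1), of "Ar A n n \<sigma> a" A] h(4,5) by simp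
  qed
  show "trans (tensor_rel A X n)"
  proof (rule transI)
    fix s t u assume "(s, t) \<in> tensor_rel A X n" "(t, u) \<in> tensor_rel A X n"
    then obtain x \<sigma> a y \<rho> where h: "x \<in> Inj n X" "\<sigma> \<in> Sym n" "a \<in> Ob A n"
      "s = (compose (seg n) x \<sigma>, a)"
      "y \<in> Inj n X" "\<rho> \<in> Sym n" "x = compose (seg n) y \<rho>"
      "u = (y, Ar A n n \<rho> (Ar A n n \<sigma> a))"
      unfolding tensor_rel_def by auto
    have "s = (compose (seg n) y (compose (seg n) \<rho> \<sigma>), a)"
      using compose_assoc[OF Sym_fun[OF h(2)], of y \<rho>] h by simp
    moreover have "u = (y, Ar A n n (compose (seg n) \<rho> \<sigma>) a)"
      using functor_S(3)[OF A] h Sym_subset_Surj by metis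
    ultimately show "(s, u) \<in> tensor_rel A X n"
      using tensor_relI[OF h(5) compose_Sym[OF h(2,6)] h(3)] by simp
  qed
qed

lemma cls_eq_iff:
  assumes A: "functor_to_Set S_cat A"
    and "x \<in> Inj n X" "a \<in> Ob A n" "y \<in> Inj n X" "b \<in> Ob A n"
  shows "cls A X n x a = cls A X n y b \<longleftrightarrow>
    (\<exists>\<sigma>\<in>Sym n. x = compose (seg n) y \<sigma> \<and> b = Ar A n n \<sigma> a)"
proof -
  have "cls A X n x a = cls A X n y b \<longleftrightarrow> ((x, a), (y, b)) \<in> tensor_rel A X n"
    unfolding cls_def using eq_equiv_class_iff[OF equiv_tensor_rel[OF A]] assms by blast
  also have "\<dots> \<longleftrightarrow> (\<exists>\<sigma>\<in>Sym n. x = compose (seg n) y \<sigma> \<and> b = Ar A n n \<sigma> a)"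
    unfolding tensor_rel_def using assms by auto
  finally show ?thesis .
qed

lemma cls_in_hat:
  "x \<in> Inj n X \<Longrightarrow> a \<in> Ob A n \<Longrightarrow> (n, cls A X n x a) \<in> Ob (hat A) X"
  unfolding hat_def cls_def tensor_def by (auto intro: quotientI)

lemma hat_cases:
  assumes "c \<in> Ob (hat A) X"
  obtains n x a where "x \<in> Inj n X" "a \<in> Ob A n" "c = (n, cls A X n x a)"
  using assms unfolding hat_def cls_def tensor_def by (auto elim!: quotientE)

lemma surj_inj_factorization:
  assumes "f \<in> X \<rightarrow> Y" "x \<in> Inj n X"
  obtains m \<alpha> y where "\<alpha> \<in> Surj n m" "y \<in> Inj m Y" "compose (seg n) f x = compose (seg n) y \<alpha>"
proof -
  let ?I = "(\<lambda>i. f (x i)) ` seg n"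
  have "?I \<subseteq> Y" using assms unfolding Inj_def by auto
  have "finite ?I" by simp
  then obtain y where y: "bij_betw y (seg (card ?I)) ?I"
    using ex_bij_betw_nat_finite_1[of ?I] by auto
  define y' where "y' = restrict y (seg (card ?I))"
  define \<alpha> where "\<alpha> = (\<lambda>i\<in>seg n. inv_into (seg (card ?I)) y (f (x i)))"
  have "y' \<in> Inj (card ?I) Y"
  proof -
    have "y i \<in> Y" if "i \<in> seg (card ?I)" for i
      using bij_betwE[OF y] \<open>?I \<subseteq> Y\<close> that by blast
    moreover have "inj_on y (seg (card ?I))" using y by (rule bij_betw_imp_inj_on)
    ultimately show ?thesis unfolding Inj_def y'_def by simp
  qed
  moreover have "\<alpha> ` seg n = seg (card ?I)"
  proof -
    have "\<alpha> ` seg n = inv_into (seg (card ?I)) y ` ?I"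
      unfolding \<alpha>_def image_image by (rule image_cong) simp_all
    then show ?thesis using bij_betw_inv_into[OF y] by (simp add: bij_betw_def)
  qed
  then have "\<alpha> \<in> Surj n (card ?I)"
  proof -
    have "\<alpha> i \<in> seg (card ?I)" if "i \<in> seg n" for i
      unfolding \<open>\<alpha> ` seg n = seg (card ?I)\<close>[symmetric] using that by (rule imageI)
    moreover have "\<alpha> \<in> extensional (seg n)" unfolding \<alpha>_def by simp
    ultimately show ?thesis
      unfolding Surj_def PiE_def using \<open>\<alpha> ` seg n = seg (card ?I)\<close> by blast
  qed
  moreover have "compose (seg n) f x = compose (seg n) y' \<alpha>"
  proof
    fix i
    show "compose (seg n) f x i = compose (seg n) y' \<alpha> i"
    proof (cases "i \<in> seg n")
      case True
      then have fi: "f (x i) \<in> ?I" by blast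
      have "\<alpha> i \<in> seg (card ?I)" using True \<open>\<alpha> ` seg n = seg (card ?I)\<close> by blast
      then have "y' (\<alpha> i) = y (\<alpha> i)" unfolding y'_def by (rule restrict_apply')
      also have "\<dots> = f (x i)"
        using True bij_betw_inv_into_right[OF y fi] unfolding \<alpha>_def by simp
      finally show ?thesis using True by (simp add: compose_eq)
    next
      case False
      then show ?thesis unfolding compose_def by (metis restrict_apply)
    qed
  qed
  ultimately show ?thesis using that by blast
qed

lemma hat_Ar_unique:
  assumes A: "functor_to_Set S_cat A"
    and x: "x \<in> Inj n X" "a \<in> Ob A n" "\<alpha> \<in> Surj n m" "y \<in> Inj m Y"
      "compose (seg n) f x = compose (seg n) y \<alpha>"
    and x': "x' \<in> Inj n X" "a' \<in> Ob A n" "\<alpha>' \<in> Surj n m'" "y' \<in> Inj m' Y"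
      "compose (seg n) f x' = compose (seg n) y' \<alpha>'"
    and eq: "cls A X n x a = cls A X n x' a'"
  shows "m = m' \<and> cls A Y m y (Ar A n m \<alpha> a) = cls A Y m' y' (Ar A n m' \<alpha>' a')"
proof -
  obtain \<sigma> where \<sigma>: "\<sigma> \<in> Sym n" "x = compose (seg n) x' \<sigma>" "a' = Ar A n n \<sigma> a"
    using eq cls_eq_iff[OF A x(1,2) x'(1,2)] by blast
  have \<sigma>im: "\<sigma> ` seg n = seg n" using \<sigma>(1) by (simp add: Sym_def bij_betw_def)
  have \<alpha>im: "\<alpha> ` seg n = seg m" "\<alpha>' ` seg n = seg m'" using x(3) x'(3) by (simp_all add: Surj_def)
  have pt: "y (\<alpha> i) = y' (\<alpha>' (\<sigma> i))" if "i \<in> seg n" for i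
  proof -
    have si: "\<sigma> i \<in> seg n" using that \<sigma>im by blast
    have "y (\<alpha> i) = f (x i)" using fun_cong[OF x(5), of i] that by (simp add: compose_eq)
    also have "\<dots> = f (x' (\<sigma> i))" using \<sigma>(2) that by (simp add: compose_eq)
    also have "\<dots> = y' (\<alpha>' (\<sigma> i))"
      using fun_cong[OF x'(5), of "\<sigma> i"] si by (simp add: compose_eq)
    finally show ?thesis .
  qed
  have "y ` seg m = (\<lambda>i. y (\<alpha> i)) ` seg n" unfolding \<alpha>im(1)[symmetric] by (simp add: image_image)
  also have "\<dots> = (\<lambda>i. y' (\<alpha>' (\<sigma> i))) ` seg n" using pt by (intro image_cong) auto
  also have "\<dots> = y' ` \<alpha>' ` \<sigma> ` seg n" by (simp add: image_image)
  also have "\<dots> = y' ` seg m'" unfolding \<sigma>im \<alpha>im ..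
  finally have im: "y ` seg m = y' ` seg m'" .
  have inj: "inj_on y (seg m)" "inj_on y' (seg m')" using x(4) x'(4) by (auto simp: Inj_def)
  have mm: "m = m'" using im card_image[OF inj(1)] card_image[OF inj(2)] by simp
  define \<rho> where "\<rho> = (\<lambda>i\<in>seg m. inv_into (seg m) y' (y i))"
  have by': "bij_betw y (seg m) (y ` seg m)" "bij_betw y' (seg m) (y ` seg m)"
    using inj im mm by (auto simp: bij_betw_def)
  have "bij_betw (inv_into (seg m) y' \<circ> y) (seg m) (seg m)"
    by (rule bij_betw_trans[OF by'(1) bij_betw_inv_into[OF by'(2)]])
  then have "bij_betw \<rho> (seg m) (seg m)"
    unfolding \<rho>_def by (simp add: comp_def)
  then have \<rho>: "\<rho> \<in> Sym m" unfolding Sym_def by (auto simp: \<rho>_def dest: bij_betwE)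
  have y\<rho>: "y' (\<rho> i) = y i" if "i \<in> seg m" for i
    using that bij_betw_inv_into_right[OF by'(2), of "y i"] unfolding \<rho>_def by simp
  have yc: "y = compose (seg m) y' \<rho>"
  proof
    fix i show "y i = compose (seg m) y' \<rho> i"
    proof (cases "i \<in> seg m")
      case True then show ?thesis using y\<rho> by (simp add: compose_eq)
    next
      case False then show ?thesis using x(4) unfolding compose_def Inj_def
        by (metis (no_types, lifting) PiE_arb mem_Collect_eq restrict_apply)
    qed
  qed
  have ac: "compose (seg n) \<alpha>' \<sigma> = compose (seg n) \<rho> \<alpha>"
  proof
    fix i show "compose (seg n) \<alpha>' \<sigma> i = compose (seg n) \<rho> \<alpha> i"
    proof (cases "i \<in> seg n")
      case True
      have a1: "\<alpha> i \<in> seg m" using True \<alpha>im by blast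
      have a2: "\<alpha>' (\<sigma> i) \<in> seg m'" using True \<sigma>im \<alpha>im by blast
      have a3: "\<rho> (\<alpha> i) \<in> seg m'" using a1 Sym_fun[OF \<rho>] mm by blast
      have "y' (\<rho> (\<alpha> i)) = y' (\<alpha>' (\<sigma> i))" using y\<rho>[OF a1] pt[OF True] by simp
      then have "\<rho> (\<alpha> i) = \<alpha>' (\<sigma> i)" using inj_onD[OF inj(2) _ a3 a2] by blast
      then show ?thesis using True by (simp add: compose_eq)
    next
      case False then show ?thesis unfolding compose_def by (metis restrict_apply)
    qed
  qed
  have "Ar A n m' \<alpha>' a' = Ar A n m (compose (seg n) \<alpha>' \<sigma>) a"
    using functor_S(3)[OF A Sym_subset_Surj[OF \<sigma>(1)] x'(3) x(2)] \<sigma>(3) mm by simp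
  also have "\<dots> = Ar A m m \<rho> (Ar A n m \<alpha> a)"
    unfolding ac using functor_S(3)[OF A x(3) Sym_subset_Surj[OF \<rho>] x(2)] .
  finally have "Ar A n m' \<alpha>' a' = Ar A m m \<rho> (Ar A n m \<alpha> a)" .
  then have "cls A Y m y (Ar A n m \<alpha> a) = cls A Y m y' (Ar A n m' \<alpha>' a')"
    using cls_eq_iff[OF A x(4) functor_S(1)[OF A x(3,2)], of y' "Ar A n m' \<alpha>' a'"]
      functor_S(1)[OF A x'(3,2)] x'(4) \<rho> yc unfolding mm[symmetric] by blast
  with mm show ?thesis by simp
qed

lemma hat_Ar_cls:
  assumes A: "functor_to_Set S_cat A"
    and x: "x \<in> Inj n X" "a \<in> Ob A n" "\<alpha> \<in> Surj n m" "y \<in> Inj m Y"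
      "compose (seg n) f x = compose (seg n) y \<alpha>"
  shows "Ar (hat A) X Y f (n, cls A X n x a) = (m, cls A Y m y (Ar A n m \<alpha> a))"
  unfolding hat_def set_functor.simps
proof (rule the_equality)
  fix d
  assume "\<exists>n' m x' a' \<alpha> y. x' \<in> Inj n' X \<and> a' \<in> Ob A n' \<and>
             (n, cls A X n x a) = (n', cls A X n' x' a') \<and>
             \<alpha> \<in> Surj n' m \<and> y \<in> Inj m Y \<and> compose (seg n') f x' = compose (seg n') y \<alpha> \<and>
             d = (m, cls A Y m y (Ar A n' m \<alpha> a'))"
  then obtain m' x' a' \<alpha>' y' where
    x': "x' \<in> Inj n X" "a' \<in> Ob A n" "\<alpha>' \<in> Surj n m'" "y' \<in> Inj m' Y"
      "compose (seg n) f x' = compose (seg n) y' \<alpha>'"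
    and eq: "cls A X n x a = cls A X n x' a'"
    and d: "d = (m', cls A Y m' y' (Ar A n m' \<alpha>' a'))"
    by auto
  show "d = (m, cls A Y m y (Ar A n m \<alpha> a))"
    unfolding d prod.inject using hat_Ar_unique[OF A x x' eq]
    by (elim conjE) (rule conjI; rule sym; assumption)
qed (rule exI[of _ n], rule exI[of _ m], rule exI[of _ x], rule exI[of _ a],
    rule exI[of _ "\<alpha>"], rule exI[of _ y], intro conjI refl x)

lemma natural_S:
  assumes "natural_transformation S_cat A B \<tau>"
  shows "a \<in> Ob A n \<Longrightarrow> \<tau> n a \<in> Ob B n"
    and "\<alpha> \<in> Surj n m \<Longrightarrow> a \<in> Ob A n \<Longrightarrow> \<tau> m (Ar A n m \<alpha> a) = Ar B n m \<alpha> (\<tau> n a)"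
  using assms unfolding natural_transformation_def S_cat_def by auto

lemma hat_trans_cls:
  assumes A: "functor_to_Set S_cat A" and B: "functor_to_Set S_cat B"
    and t: "natural_transformation S_cat A B \<tau>"
    and x: "x \<in> Inj n X" "a \<in> Ob A n"
  shows "hat_trans A B \<tau> X (n, cls A X n x a) = (n, cls B X n x (\<tau> n a))"
  unfolding hat_trans_def
proof (rule the_equality)
  fix d
  assume "\<exists>n' x' a'. x' \<in> Inj n' X \<and> a' \<in> Ob A n' \<and>
     (n, cls A X n x a) = (n', cls A X n' x' a') \<and> d = (n', cls B X n' x' (\<tau> n' a'))"
  then obtain x' a' where x': "x' \<in> Inj n X" "a' \<in> Ob A n"
    and eq: "cls A X n x a = cls A X n x' a'" and d: "d = (n, cls B X n x' (\<tau> n a'))"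
    by auto
  obtain \<sigma> where \<sigma>: "\<sigma> \<in> Sym n" "x = compose (seg n) x' \<sigma>" "a' = Ar A n n \<sigma> a"
    using eq cls_eq_iff[OF A x x'] by blast
  have "\<tau> n a' = Ar B n n \<sigma> (\<tau> n a)"
    using natural_S(2)[OF t Sym_subset_Surj[OF \<sigma>(1)] x(2)] \<sigma>(3) by simp
  then have "cls B X n x (\<tau> n a) = cls B X n x' (\<tau> n a')"
    using cls_eq_iff[OF B x(1) natural_S(1)[OF t x(2)] x'(1) natural_S(1)[OF t x'(2)]] \<sigma> by blast
  then show "d = (n, cls B X n x (\<tau> n a))" using d by simp
qed (rule exI[of _ n], rule exI[of _ x], rule exI[of _ a], intro conjI refl x)

lemma functor_hat:
  assumes A: "functor_to_Set S_cat A"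
  shows "functor_to_Set Set_cat (hat A)"
  unfolding functor_to_Set_def
proof (intro conjI allI ballI funcsetI)
  fix X Y :: "'b set" and f c assume "f \<in> Hom Set_cat X Y" and c: "c \<in> Ob (hat A) X"
  then have f: "f \<in> X \<rightarrow> Y" by (auto simp: Set_cat_def)
  from c obtain n x a where x: "x \<in> Inj n X" "a \<in> Ob A n" "c = (n, cls A X n x a)" by (rule hat_cases)
  from f x(1) obtain m \<alpha> y where y: "\<alpha> \<in> Surj n m" "y \<in> Inj m Y"
    "compose (seg n) f x = compose (seg n) y \<alpha>" by (rule surj_inj_factorization)
  show "Ar (hat A) X Y f c \<in> Ob (hat A) Y"
    using hat_Ar_cls[OF A x(1,2) y] cls_in_hat[OF y(2) functor_S(1)[OF A y(1) x(2)]] x(3) by simp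
next
  fix X :: "'b set" and c assume "c \<in> Ob (hat A) X"
  then obtain n x a where x: "x \<in> Inj n X" "a \<in> Ob A n" "c = (n, cls A X n x a)" by (rule hat_cases)
  have e: "compose (seg n) (\<lambda>x\<in>X. x) x = compose (seg n) x (\<lambda>i\<in>seg n. i)"
    using Id_compose[of x "seg n" X] Inj_compose_Id[OF x(1)] x(1) unfolding Inj_def PiE_def by auto
  show "Ar (hat A) X X (Id Set_cat X) c = c"
    using hat_Ar_cls[OF A x(1,2) Sym_subset_Surj[OF Id_Sym] x(1) e] x functor_S(2)[OF A x(2)]
    by (simp add: Set_cat_def)
next
  fix X Y Z :: "'b set" and f g c
  assume "f \<in> Hom Set_cat X Y" "g \<in> Hom Set_cat Y Z" and c: "c \<in> Ob (hat A) X"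
  then have f: "f \<in> X \<rightarrow> Y" and g: "g \<in> Y \<rightarrow> Z" by (auto simp: Set_cat_def)
  from c obtain n x a where x: "x \<in> Inj n X" "a \<in> Ob A n" "c = (n, cls A X n x a)" by (rule hat_cases)
  from f x(1) obtain m \<alpha> y where y: "\<alpha> \<in> Surj n m" "y \<in> Inj m Y"
    "compose (seg n) f x = compose (seg n) y \<alpha>" by (rule surj_inj_factorization)
  from g y(2) obtain k \<beta> z where z: "\<beta> \<in> Surj m k" "z \<in> Inj k Z"
    "compose (seg m) g y = compose (seg m) z \<beta>" by (rule surj_inj_factorization)
  have xf: "x \<in> seg n \<rightarrow> X" using x(1) by (auto simp: Inj_def)
  have af: "\<alpha> \<in> seg n \<rightarrow> seg m" using y(1) by (auto simp: Surj_def)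
  have s: "compose (seg n) \<beta> \<alpha> \<in> Surj n k"
    using y(1) z(1) surj_compose[of \<alpha> "seg n" "seg m" \<beta> "seg k"]
      funcset_compose[of \<alpha> "seg n" "seg m" \<beta> "seg k"]
    unfolding Surj_def PiE_def by auto
  have "compose (seg n) (compose X g f) x = compose (seg n) g (compose (seg n) y \<alpha>)"
    using compose_assoc[OF xf, of g f] y(3) by simp
  also have "\<dots> = compose (seg n) (compose (seg m) z \<beta>) \<alpha>"
    using compose_assoc[OF af, of g y] z(3) by simp
  also have "\<dots> = compose (seg n) z (compose (seg n) \<beta> \<alpha>)"
    using compose_assoc[OF af, of z \<beta>] by simp
  finally have e: "compose (seg n) (compose X g f) x = compose (seg n) z (compose (seg n) \<beta> \<alpha>)" .
  show "Ar (hat A) X Z (Comp Set_cat X Y Z g f) c = Ar (hat A) Y Z g (Ar (hat A) X Y f c)"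
    using hat_Ar_cls[OF A x(1,2) s z(2) e] hat_Ar_cls[OF A x(1,2) y]
      hat_Ar_cls[OF A y(2) functor_S(1)[OF A y(1) x(2)] z] functor_S(3)[OF A y(1) z(1) x(2)] x(3)
    by (simp add: Set_cat_def)
qed

lemma natural_hat_trans:
  assumes A: "functor_to_Set S_cat A" and B: "functor_to_Set S_cat B"
    and t: "natural_transformation S_cat A B \<tau>"
  shows "natural_transformation Set_cat (hat A) (hat B) (hat_trans A B \<tau>)"
  unfolding natural_transformation_def
proof (intro conjI allI ballI funcsetI)
  fix X :: "'c set" and c assume "c \<in> Ob (hat A) X"
  then obtain n x a where x: "x \<in> Inj n X" "a \<in> Ob A n" "c = (n, cls A X n x a)" by (rule hat_cases)
  show "hat_trans A B \<tau> X c \<in> Ob (hat B) X"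
    using hat_trans_cls[OF A B t x(1,2)] cls_in_hat[OF x(1) natural_S(1)[OF t x(2)]] x(3) by simp
next
  fix X Y :: "'c set" and f c assume "f \<in> Hom Set_cat X Y" and c: "c \<in> Ob (hat A) X"
  then have f: "f \<in> X \<rightarrow> Y" by (auto simp: Set_cat_def)
  from c obtain n x a where x: "x \<in> Inj n X" "a \<in> Ob A n" "c = (n, cls A X n x a)" by (rule hat_cases)
  from f x(1) obtain m \<alpha> y where y: "\<alpha> \<in> Surj n m" "y \<in> Inj m Y"
    "compose (seg n) f x = compose (seg n) y \<alpha>" by (rule surj_inj_factorization)
  show "hat_trans A B \<tau> Y (Ar (hat A) X Y f c) = Ar (hat B) X Y f (hat_trans A B \<tau> X c)"
    using hat_Ar_cls[OF A x(1,2) y] hat_trans_cls[OF A B t x(1,2)]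
      hat_trans_cls[OF A B t y(2) functor_S(1)[OF A y(1) x(2)]]
      hat_Ar_cls[OF B x(1) natural_S(1)[OF t x(2)] y] natural_S(2)[OF t y(1) x(2)] x(3)
    by simp
qed

end

theory Submission
  imports Defs
begin

text \<open>
  Weak pullbacks can be tested on elements. An element of \<open>hat A\<close> over \<open>X\<close> lying above the class
  of \<open>(x, b)\<close> is, after moving a permutation across the tensor, the class of some \<open>(x, a)\<close> with
  \<open>\<tau> n a = b\<close> and the same \<open>x\<close>. So a lifting problem for \<open>hat_trans A B \<tau>\<close> at \<open>f\<close> is a lifting problem
  for \<open>\<tau>\<close> at the surjective part of \<open>f \<circ> x\<close>; conversely, every surjection \<open>\<alpha>\<close> from \<open>seg n\<close> to \<open>seg m\<close> is
  the surjective part of such an \<open>f \<circ> x\<close>, because the universe contains copies of \<open>seg n\<close> and \<open>seg m\<close>, and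
  the class of \<open>(y, a)\<close> determines \<open>a\<close> once \<open>y\<close> is fixed, since \<open>y\<close> is injective.
\<close>

text \<open>Functoriality and naturality already supply the typing and commutation clauses of
  \<open>weak_pullback_iff_elements\<close>, so only the existence of lifts remains.\<close>

lemma weakly_cartesian_iff_elements:
  assumes F: "functor_to_Set C F" and G: "functor_to_Set C G"
    and t: "natural_transformation C F G \<tau>"
  shows "weakly_cartesian TYPE('q) C F G \<tau> \<longleftrightarrow>
    (\<forall>X Y. \<forall>f\<in>Hom C X Y. \<forall>a\<in>Ob F Y. \<forall>b\<in>Ob G X. \<tau> Y a = Ar G X Y f b \<longrightarrow>
      (\<exists>c\<in>Ob F X. Ar F X Y f c = a \<and> \<tau> X c = b))"
proof -
  have "weak_pullback TYPE('q) (Ob F X) (Ob F Y) (Ob G X) (Ob G Y)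
          (Ar F X Y f) (\<tau> X) (\<tau> Y) (Ar G X Y f) \<longleftrightarrow>
    (\<forall>a\<in>Ob F Y. \<forall>b\<in>Ob G X. \<tau> Y a = Ar G X Y f b \<longrightarrow>
      (\<exists>c\<in>Ob F X. Ar F X Y f c = a \<and> \<tau> X c = b))"
    if "f \<in> Hom C X Y" for X Y f
  proof -
    have "Ar F X Y f \<in> Ob F X \<rightarrow> Ob F Y" "Ar G X Y f \<in> Ob G X \<rightarrow> Ob G Y"
      using F G that by (simp_all add: functor_to_Set_def)
    moreover have "\<tau> X \<in> Ob F X \<rightarrow> Ob G X" "\<tau> Y \<in> Ob F Y \<rightarrow> Ob G Y"
      "\<forall>c\<in>Ob F X. \<tau> Y (Ar F X Y f c) = Ar G X Y f (\<tau> X c)"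
      using t that by (simp_all add: natural_transformation_def)
    ultimately show ?thesis
      unfolding weak_pullback_iff_elements
      by - (intro iffI; (elim conjE)?; (intro conjI)?; assumption)
  qed
  then show ?thesis unfolding weakly_cartesian_def by (simp cong: ball_cong)
qed

text \<open>Permutations act freely on injections: a \<sigma> with
  \<open>x = compose (seg n) x \<sigma>\<close> must be the identity.\<close>

lemma cls_eq_imp_eq:
  assumes A: "functor_to_Set S_cat A"
    and x: "x \<in> Inj n X" and a: "a \<in> Ob A n" and b: "b \<in> Ob A n"
    and eq: "cls A X n x a = cls A X n x b"
  shows "a = b"
proof -
  obtain \<sigma> where \<sigma>: "\<sigma> \<in> Sym n" "x = compose (seg n) x \<sigma>" "b = Ar A n n \<sigma> a"
    using eq cls_eq_iff[OF A x a x b] by blast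
  have "\<sigma> = (\<lambda>i\<in>seg n. i)"
  proof
    fix i show "\<sigma> i = (\<lambda>i\<in>seg n. i) i"
    proof (cases "i \<in> seg n")
      case True
      have "x i = x (\<sigma> i)" using fun_cong[OF \<sigma>(2), of i] True by (simp add: compose_eq)
      moreover have "\<sigma> i \<in> seg n" using Sym_fun[OF \<sigma>(1)] True by blast
      moreover have "inj_on x (seg n)" using x by (simp add: Inj_def)
      ultimately show ?thesis using True by (metis inj_onD restrict_apply')
    next
      case False
      \<comment> \<open>Off \<open>seg n\<close> both sides are \<open>undefined\<close>, as
        \<sigma> is extensional.\<close>
      then show ?thesis using \<sigma>(1) unfolding Sym_def
        by (metis (no_types, lifting) PiE_arb mem_Collect_eq restrict_apply)
    qed
  qed
  then show ?thesis using \<sigma>(3) functor_S(2)[OF A a] by simp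
qed

lemma hat_trans_eq_clsE:
  assumes A: "functor_to_Set S_cat A" and B: "functor_to_Set S_cat B"
    and t: "natural_transformation S_cat A B \<tau>"
    and c: "c \<in> Ob (hat A) X" and x: "x \<in> Inj n X" and b: "b \<in> Ob B n"
    and eq: "hat_trans A B \<tau> X c = (n, cls B X n x b)"
  obtains a where "a \<in> Ob A n" "c = (n, cls A X n x a)" "\<tau> n a = b"
proof -
  obtain n' x' a' where x': "x' \<in> Inj n' X" "a' \<in> Ob A n'" and c': "c = (n', cls A X n' x' a')"
    using c by (rule hat_cases)
  have "(n', cls B X n' x' (\<tau> n' a')) = (n, cls B X n x b)"
    using eq unfolding c' hat_trans_cls[OF A B t x'] .
  then have n: "n' = n" and e: "cls B X n x' (\<tau> n a') = cls B X n x b"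
    unfolding prod.inject by (elim conjE, simp only:)+
  note x' = x'[unfolded n]
  obtain \<sigma> where \<sigma>: "\<sigma> \<in> Sym n" "x' = compose (seg n) x \<sigma>" "b = Ar B n n \<sigma> (\<tau> n a')"
    using e cls_eq_iff[OF B x'(1) natural_S(1)[OF t x'(2)] x b] by blast
  \<comment> \<open>Since x' is x after \<sigma>, moving \<sigma> across the tensor turns the pair
    (x', a') into (x, \<open>?a\<close>).\<close>
  let ?a = "Ar A n n \<sigma> a'"
  have a: "?a \<in> Ob A n" using functor_S(1)[OF A Sym_subset_Surj[OF \<sigma>(1)] x'(2)] .
  moreover have "cls A X n x' a' = cls A X n x ?a"
    using cls_eq_iff[OF A x' x a] \<sigma> by blast
  moreover have "\<tau> n ?a = b"
    using natural_S(2)[OF t Sym_subset_Surj[OF \<sigma>(1)] x'(2)] \<sigma>(3) by simp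
  ultimately show ?thesis using that c' n by simp
qed

lemma infinite_UNIV_obtains_Inj:
  assumes "infinite (UNIV :: 'x set)"
  obtains x where "x \<in> Inj n (UNIV :: 'x set)"
proof -
  obtain S :: "'x set" where S: "finite S" "card S = n"
    using infinite_arbitrarily_large[OF assms] by blast
  then obtain x where "bij_betw x (seg n) S"
    using ex_bij_betw_nat_finite_1[OF S(1)] by auto
  then have "restrict x (seg n) \<in> Inj n UNIV"
    unfolding Inj_def by (simp add: bij_betw_imp_inj_on)
  then show ?thesis using that by blast
qed

text \<open>On the image of x take y after \<alpha> after the inverse of x; the values elsewhere are
  arbitrary.\<close>

lemma Inj_extension:
  assumes "x \<in> Inj n X"
  obtains f where "compose (seg n) f x = compose (seg n) y \<alpha>"
proof -
  have "inj_on x (seg n)" using assms by (simp add: Inj_def)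
  then have "compose (seg n) (\<lambda>z. y (\<alpha> (inv_into (seg n) x z))) x = compose (seg n) y \<alpha>"
    unfolding compose_def by (intro restrict_ext) (simp add: inv_into_f_f)
  then show ?thesis using that by blast
qed

theorem proposition7p3:
  fixes A :: "'a S_functor" and B :: "'b S_functor" and \<tau> :: "nat \<Rightarrow> 'a \<Rightarrow> 'b"
  assumes "functor_to_Set S_cat A" and "functor_to_Set S_cat B"
    and "natural_transformation S_cat A B \<tau>"
    and "infinite (UNIV :: 'x set)"
  shows "weakly_cartesian TYPE('q) S_cat A B \<tau> \<longleftrightarrow>
         weakly_cartesian TYPE('q) (Set_cat :: ('x set, 'x \<Rightarrow> 'x) category)
           (hat A) (hat B) (hat_trans A B \<tau>)"
    (is "?L \<longleftrightarrow> ?R")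
proof -
  note A = assms(1) and B = assms(2) and t = assms(3)
  note L_iff = weakly_cartesian_iff_elements[OF A B t]
  note R_iff = weakly_cartesian_iff_elements[OF functor_hat[OF A] functor_hat[OF B]
      natural_hat_trans[OF A B t]]
  show ?thesis
  proof
    assume ?L
    then have lift: "\<exists>c\<in>Ob A n. Ar A n m \<alpha> c = a \<and> \<tau> n c = b"
      if "\<alpha> \<in> Surj n m" "a \<in> Ob A m" "b \<in> Ob B n" "\<tau> m a = Ar B n m \<alpha> b" for n m \<alpha> a b
      using that unfolding L_iff by (simp add: S_cat_def)
    show ?R unfolding R_iff
    proof (intro allI ballI impI)
      fix X Y :: "'x set" and f p q
      assume "f \<in> Hom Set_cat X Y" and p: "p \<in> Ob (hat A) Y" and q: "q \<in> Ob (hat B) X"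
        and eq: "hat_trans A B \<tau> Y p = Ar (hat B) X Y f q"
      then have f: "f \<in> X \<rightarrow> Y" by (auto simp: Set_cat_def)
      from q obtain n x b where x: "x \<in> Inj n X" "b \<in> Ob B n" and q': "q = (n, cls B X n x b)"
        by (rule hat_cases)
      from f x(1) obtain m \<alpha> y where y: "\<alpha> \<in> Surj n m" "y \<in> Inj m Y"
        "compose (seg n) f x = compose (seg n) y \<alpha>" by (rule surj_inj_factorization)
      \<comment> \<open>This puts the image of p in a form with first component y, so p itself can
        be represented with the same y.\<close>
      have "hat_trans A B \<tau> Y p = (m, cls B Y m y (Ar B n m \<alpha> b))"
        using eq q' hat_Ar_cls[OF B x y] by simp
      from hat_trans_eq_clsE[OF A B t p y(2) functor_S(1)[OF B y(1) x(2)] this]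
      obtain a where a: "a \<in> Ob A m" "p = (m, cls A Y m y a)" "\<tau> m a = Ar B n m \<alpha> b" .
      from lift[OF y(1) a(1) x(2) a(3)]
      obtain c where c: "c \<in> Ob A n" "Ar A n m \<alpha> c = a" "\<tau> n c = b" by blast
      \<comment> \<open>The factorization of f after x does not involve the functor, so \<alpha> and
        y compute the action of f for \<open>hat A\<close> as well as for
        \<open>hat B\<close>.\<close>
      have "Ar (hat A) X Y f (n, cls A X n x c) = p"
        using hat_Ar_cls[OF A x(1) c(1) y] c(2) a(2) by simp
      moreover have "hat_trans A B \<tau> X (n, cls A X n x c) = q"
        using hat_trans_cls[OF A B t x(1) c(1)] c(3) q' by simp
      ultimately show "\<exists>r\<in>Ob (hat A) X. Ar (hat A) X Y f r = p \<and> hat_trans A B \<tau> X r = q"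
        using cls_in_hat[of x n X c A, OF x(1) c(1)] by blast
    qed
  next
    \<comment> \<open>With the whole universe as source and target, every HOL function f is an
      arrow, since extensionality on \<open>UNIV\<close> is no restriction.\<close>
    let ?U = "UNIV :: 'x set"
    assume ?R
    then have lift: "\<exists>r\<in>Ob (hat A) ?U. Ar (hat A) ?U ?U f r = p \<and> hat_trans A B \<tau> ?U r = q"
      if "p \<in> Ob (hat A) ?U" "q \<in> Ob (hat B) ?U"
        "hat_trans A B \<tau> ?U p = Ar (hat B) ?U ?U f q" for f p q
      using that unfolding R_iff by (simp add: Set_cat_def)
    show ?L unfolding L_iff
    proof (intro allI ballI impI)
      fix n m \<alpha> a b
      assume "\<alpha> \<in> Hom S_cat n m" and a: "a \<in> Ob A m" and b: "b \<in> Ob B n"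
        and eq: "\<tau> m a = Ar B n m \<alpha> b"
      then have \<alpha>: "\<alpha> \<in> Surj n m" by (simp add: S_cat_def)
      obtain x where x: "x \<in> Inj n ?U" using infinite_UNIV_obtains_Inj[OF assms(4)] .
      obtain y where y: "y \<in> Inj m ?U" using infinite_UNIV_obtains_Inj[OF assms(4)] .
      obtain f where f: "compose (seg n) f x = compose (seg n) y \<alpha>" using Inj_extension[OF x] .
      have "hat_trans A B \<tau> ?U (m, cls A ?U m y a) = Ar (hat B) ?U ?U f (n, cls B ?U n x b)"
        using hat_trans_cls[OF A B t y a] hat_Ar_cls[OF B x b \<alpha> y f] eq by simp
      from lift[OF cls_in_hat[OF y a] cls_in_hat[OF x b] this]
      obtain r where r: "r \<in> Ob (hat A) ?U" "Ar (hat A) ?U ?U f r = (m, cls A ?U m y a)"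
        "hat_trans A B \<tau> ?U r = (n, cls B ?U n x b)" by blast
      from hat_trans_eq_clsE[OF A B t r(1) x b r(3)]
      obtain c where c: "c \<in> Ob A n" "r = (n, cls A ?U n x c)" "\<tau> n c = b" .
      \<comment> \<open>Both classes carry the same injection y, so freeness of the action recovers
        the equation in \<open>Ob A m\<close>.\<close>
      have "cls A ?U m y (Ar A n m \<alpha> c) = cls A ?U m y a"
        using r(2) c(2) hat_Ar_cls[OF A x c(1) \<alpha> y f] by simp
      then have "Ar A n m \<alpha> c = a"
        using cls_eq_imp_eq[OF A y functor_S(1)[OF A \<alpha> c(1)] a] by blast
      with c show "\<exists>c\<in>Ob A n. Ar A n m \<alpha> c = a \<and> \<tau> n c = b" by blast
    qed
  qed
qed

end
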